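(* Let $m\ge 1$, $\alpha_0,\beta_0,\eta_0\in\mathbb{R}$ and $\alpha=(\alpha_1,\dots,\alpha_m)$, $\beta=(\beta_1,\dots,\beta_m)$, $\eta=(\eta_1,\dots,\eta_m)\in\mathbb{R}^m$. Suppose that $\alpha_0\ge 0$, $\alpha_0+|\beta_0|>0$ and $$\left(\frac{\sum_{i=1}^{m}|\alpha_i|}{\alpha_0}\right)^2+\left(\frac{\sum_{i=1}^{m}|\beta_i|}{\beta_0}\right)^2<1,$$ with the convention that if a denominator is zero then the corresponding numerator must also be zero and the corresponding fraction is omitted. Suppose also that $\lambda\ge 0$. Then the set of solutions $u$ of the problem $$-u''=\lambda u\ \text{ on }\mathbb{R},\qquad \alpha_0u(\eta_0)+\beta_0u'(\eta_0)=\sum_{i=1}^m\alpha_iu(\eta_i)+\sum_{i=1}^m\beta_iu'(\eta_i)$$ is one-dimensional.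
   Context: Solutions are real-valued functions $u\in C^2(\mathbb{R})$; $\beta_0$ may have either sign. The set of solutions is a real vector space (including $u=0$). *)

theory Defs
  imports "HOL-Analysis.Analysis" "HOL-Library.Function_Algebras"
begin

definition C2 :: "(real \<Rightarrow> real) \<Rightarrow> bool" where
  "C2 u \<longleftrightarrow>
     (\<forall>x. u differentiable (at x)) \<and>
     (\<forall>x. deriv u differentiable (at x)) \<and>
     continuous_on UNIV (deriv (deriv u))"

text \<open>Functions carry no \<open>real_vector\<close> instance in the library. Addition and zero are the
  pointwise ones of \<open>HOL-Library.Function_Algebras\<close>; together with pointwise scaling they form
  a vector space in the sense of the locale \<open>vector_space\<close>, whose \<open>subspace\<close> and \<open>dim\<close> are used.\<close>

definition fun_scale :: "real \<Rightarrow> (real \<Rightarrow> real) \<Rightarrow> (real \<Rightarrow> real)" where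
  "fun_scale c u = (\<lambda>x. c * u x)"

global_interpretation real_fun: vector_space fun_scale
  by unfold_locales (auto simp: fun_scale_def fun_eq_iff algebra_simps)

text \<open>The coefficient vectors are functions on the natural numbers, of which only the values
  at \<open>1, \<dots>, m\<close> matter; the data with index \<open>0\<close> are the separate parameters
  \<open>\<alpha>0\<close>, \<open>\<beta>0\<close>, \<open>\<eta>0\<close>.\<close>

definition solutions ::
  "nat \<Rightarrow> real \<Rightarrow> real \<Rightarrow> real \<Rightarrow> (nat \<Rightarrow> real) \<Rightarrow> (nat \<Rightarrow> real) \<Rightarrow> (nat \<Rightarrow> real) \<Rightarrow> real
    \<Rightarrow> (real \<Rightarrow> real) set" where
  "solutions m \<alpha>0 \<beta>0 \<eta>0 \<alpha> \<beta> \<eta> lam =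
     {u. C2 u \<and>
         (\<forall>x. - deriv (deriv u) x = lam * u x) \<and>
         \<alpha>0 * u \<eta>0 + \<beta>0 * deriv u \<eta>0 =
           (\<Sum>i=1..m. \<alpha> i * u (\<eta> i)) + (\<Sum>i=1..m. \<beta> i * deriv u (\<eta> i))}"

text \<open>A vanishing denominator forces the numerator to vanish, and the fraction is then
  omitted from the sum.\<close>

definition coeff_cond ::
  "nat \<Rightarrow> real \<Rightarrow> real \<Rightarrow> (nat \<Rightarrow> real) \<Rightarrow> (nat \<Rightarrow> real) \<Rightarrow> bool" where
  "coeff_cond m \<alpha>0 \<beta>0 \<alpha> \<beta> \<longleftrightarrow>
     (\<alpha>0 = 0 \<longrightarrow> (\<Sum>i=1..m. \<bar>\<alpha> i\<bar>) = 0) \<and>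
     (\<beta>0 = 0 \<longrightarrow> (\<Sum>i=1..m. \<bar>\<beta> i\<bar>) = 0) \<and>
     (if \<alpha>0 = 0 then 0 else ((\<Sum>i=1..m. \<bar>\<alpha> i\<bar>) / \<alpha>0)\<^sup>2) +
     (if \<beta>0 = 0 then 0 else ((\<Sum>i=1..m. \<bar>\<beta> i\<bar>) / \<beta>0)\<^sup>2) < 1"

end

theory Submission
  imports Defs
begin

text \<open>The equation \<open>- u'' = s\<^sup>2 u\<close> has a two-dimensional solution space, spanned by the solutions \<open>C\<close>
  and \<open>S\<close> with initial values \<open>(1, 0)\<close> and \<open>(0, 1)\<close> at the origin. The nonlocal condition is the
  vanishing of one linear functional on this plane (the boundary defect below), so the solution set
  is a line as soon as the functional is not identically zero on the plane.

  To see that it is nonzero, combine its values on \<open>C\<close> and \<open>S\<close> into one complex number: since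
  \<open>C x + \<i> s S x = exp (\<i> s x)\<close>, the defect becomes
  \<open>z\<^sub>0 exp (\<i> s \<eta>\<^sub>0) - (\<Sum>i. z\<^sub>i exp (\<i> s \<eta>\<^sub>i))\<close> with the phasors \<open>z\<^sub>i = \<alpha>\<^sub>i + \<i> s \<beta>\<^sub>i\<close>. With
  \<open>A = (\<Sum>i. \<bar>\<alpha>\<^sub>i\<bar>)\<close> and \<open>B = (\<Sum>i. \<bar>\<beta>\<^sub>i\<bar>)\<close>, the sum has modulus at most \<open>A + s B\<close>, and the
  Cauchy-Schwarz inequality together with the coefficient condition gives
  \<open>A + s B < \<bar>z\<^sub>0\<bar>\<close>. The argument needs \<open>z\<^sub>0 \<noteq> 0\<close>, which fails only if \<open>\<alpha>\<^sub>0 = 0\<close> and \<open>s = 0\<close>; then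
  the defect of \<open>S x = x\<close> is \<open>\<beta>\<^sub>0 - (\<Sum>i. \<beta>\<^sub>i)\<close>, which is nonzero because \<open>B < \<bar>\<beta>\<^sub>0\<bar>\<close>.\<close>

section \<open>The harmonic equation\<close>

definition fund_cos :: "real \<Rightarrow> real \<Rightarrow> real" where
  "fund_cos s x = cos (s * x)"

text \<open>The normalisation by \<open>s\<close> makes the slope at the origin equal to \<open>1\<close>, so that the formulas
  below hold without change at \<open>s = 0\<close>, where the limit of \<open>sin (s * x) / s\<close> is taken.\<close>

definition fund_sin :: "real \<Rightarrow> real \<Rightarrow> real" where
  "fund_sin s x = (if s = 0 then x else sin (s * x) / s)"

lemma fund_at_0 [simp]: "fund_cos s 0 = 1" "fund_sin s 0 = 0"
  by (simp_all add: fund_cos_def fund_sin_def)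

lemma mult_fund_sin: "s * fund_sin s x = sin (s * x)"
  by (simp add: fund_sin_def)

lemma fund_pythagoras: "(fund_cos s x)\<^sup>2 + s\<^sup>2 * (fund_sin s x)\<^sup>2 = 1"
  using mult_fund_sin[of s x]
  by (simp add: fund_cos_def flip: power_mult_distrib)

lemma fund_cos_deriv: "(fund_cos s has_real_derivative - s\<^sup>2 * fund_sin s x) (at x)"
proof -
  have "((\<lambda>x. cos (s * x)) has_real_derivative - (s * sin (s * x))) (at x)"
    by (auto intro!: derivative_eq_intros)
  then show ?thesis
    by (simp add: fund_cos_def[abs_def] power2_eq_square mult_fund_sin mult.assoc)
qed

lemma fund_sin_deriv: "(fund_sin s has_real_derivative fund_cos s x) (at x)"
  by (cases "s = 0")
    (auto simp: fund_sin_def[abs_def] fund_cos_def intro!: derivative_eq_intros)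

text \<open>Uniqueness for the initial value problem: \<open>u C - u' S\<close> and \<open>s\<^sup>2 u S + u' C\<close> are first
  integrals, and by \<open>C\<^sup>2 + s\<^sup>2 S\<^sup>2 = 1\<close> they determine \<open>u\<close>.\<close>

lemma harmonic_solution_unique:
  fixes u v :: "real \<Rightarrow> real"
  assumes u: "\<And>x. (u has_real_derivative v x) (at x)"
    and v: "\<And>x. (v has_real_derivative - s\<^sup>2 * u x) (at x)"
  shows "u x = u 0 * fund_cos s x + v 0 * fund_sin s x"
proof -
  let ?C = "fund_cos s" and ?S = "fund_sin s"
  note d = u v fund_cos_deriv fund_sin_deriv
  have "((\<lambda>x. u x * ?C x - v x * ?S x) has_real_derivative 0) (at x)" for x
    by (rule derivative_eq_intros d refl)+ (simp add: algebra_simps)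
  then have "u x * ?C x - v x * ?S x = u 0 * ?C 0 - v 0 * ?S 0"
    by (intro DERIV_isconst_all) simp
  then have e1: "u x * ?C x - v x * ?S x = u 0"
    by simp
  have "((\<lambda>x. s\<^sup>2 * (u x * ?S x) + v x * ?C x) has_real_derivative 0) (at x)" for x
    by (rule derivative_eq_intros d refl)+ (simp add: algebra_simps)
  then have "s\<^sup>2 * (u x * ?S x) + v x * ?C x = s\<^sup>2 * (u 0 * ?S 0) + v 0 * ?C 0"
    by (intro DERIV_isconst_all) simp
  then have e2: "s\<^sup>2 * (u x * ?S x) + v x * ?C x = v 0"
    by simp
  have "u 0 * ?C x + v 0 * ?S x = u x * ((?C x)\<^sup>2 + s\<^sup>2 * (?S x)\<^sup>2)"
    unfolding e1[symmetric] e2[symmetric] by (simp add: algebra_simps power2_eq_square)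
  then show ?thesis
    by (simp add: fund_pythagoras)
qed

lemma
  fixes a b s :: real
  defines "w \<equiv> \<lambda>x. a * fund_cos s x + b * fund_sin s x"
  shows deriv_fund_comb: "deriv w = (\<lambda>x. a * (- s\<^sup>2 * fund_sin s x) + b * fund_cos s x)"
    and deriv2_fund_comb: "deriv (deriv w) = (\<lambda>x. - s\<^sup>2 * w x)"
    and C2_fund_comb: "C2 w"
proof -
  let ?w' = "\<lambda>x. a * (- s\<^sup>2 * fund_sin s x) + b * fund_cos s x"
  have d1: "(w has_real_derivative ?w' x) (at x)" for x
    unfolding w_def
    by (rule derivative_eq_intros fund_cos_deriv fund_sin_deriv refl)+ simp
  have d2: "(?w' has_real_derivative - s\<^sup>2 * w x) (at x)" for x
    unfolding w_def
    by (rule derivative_eq_intros fund_cos_deriv fund_sin_deriv refl)+ (simp add: algebra_simps)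
  show w': "deriv w = ?w'"
    using d1 by (auto intro!: DERIV_imp_deriv)
  show w'': "deriv (deriv w) = (\<lambda>x. - s\<^sup>2 * w x)"
    unfolding w' using d2 by (auto intro!: DERIV_imp_deriv)
  have "continuous_on UNIV w"
    using d1 by (meson DERIV_continuous continuous_at_imp_continuous_on)
  then show "C2 w"
    unfolding C2_def w'' unfolding w'
    using d1 d2 by (auto simp: real_differentiable_def intro!: continuous_intros)
qed

lemma harmonic_iff_fund_comb:
  "(C2 u \<and> (\<forall>x. - deriv (deriv u) x = s\<^sup>2 * u x)) \<longleftrightarrow>
   (\<exists>a b. u = (\<lambda>x. a * fund_cos s x + b * fund_sin s x))"
proof
  assume *: "C2 u \<and> (\<forall>x. - deriv (deriv u) x = s\<^sup>2 * u x)"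
  have u: "(u has_real_derivative deriv u x) (at x)" for x
    using * by (simp add: C2_def DERIV_deriv_iff_real_differentiable)
  have "deriv (deriv u) x = - s\<^sup>2 * u x" for x
    using * by (metis minus_minus mult_minus_left)
  then have u': "(deriv u has_real_derivative - s\<^sup>2 * u x) (at x)" for x
    using * by (metis C2_def DERIV_deriv_iff_real_differentiable)
  show "\<exists>a b. u = (\<lambda>x. a * fund_cos s x + b * fund_sin s x)"
    using harmonic_solution_unique[OF u u'] by blast
next
  assume "\<exists>a b. u = (\<lambda>x. a * fund_cos s x + b * fund_sin s x)"
  then show "C2 u \<and> (\<forall>x. - deriv (deriv u) x = s\<^sup>2 * u x)"
    using C2_fund_comb deriv2_fund_comb by auto
qed

section \<open>The boundary functional on the solution plane\<close>

text \<open>Function and derivative are separate arguments, so that the defect is linear without any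
  differentiability hypothesis.\<close>

definition boundary_defect ::
  "nat \<Rightarrow> real \<Rightarrow> real \<Rightarrow> real \<Rightarrow> (nat \<Rightarrow> real) \<Rightarrow> (nat \<Rightarrow> real) \<Rightarrow> (nat \<Rightarrow> real)
    \<Rightarrow> (real \<Rightarrow> real) \<Rightarrow> (real \<Rightarrow> real) \<Rightarrow> real" where
  "boundary_defect m \<alpha>0 \<beta>0 \<eta>0 \<alpha> \<beta> \<eta> u v =
     \<alpha>0 * u \<eta>0 + \<beta>0 * v \<eta>0 - (\<Sum>i=1..m. \<alpha> i * u (\<eta> i) + \<beta> i * v (\<eta> i))"

lemma boundary_defect_linear:
  "boundary_defect m \<alpha>0 \<beta>0 \<eta>0 \<alpha> \<beta> \<eta>
     (\<lambda>x. a * u1 x + b * u2 x) (\<lambda>x. a * v1 x + b * v2 x) =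
   a * boundary_defect m \<alpha>0 \<beta>0 \<eta>0 \<alpha> \<beta> \<eta> u1 v1 +
   b * boundary_defect m \<alpha>0 \<beta>0 \<eta>0 \<alpha> \<beta> \<eta> u2 v2"
  by (simp add: boundary_defect_def algebra_simps sum.distrib sum_distrib_left)

lemma coeff_cond_ratios:
  assumes "coeff_cond m \<alpha>0 \<beta>0 \<alpha> \<beta>"
  obtains p q where "p\<^sup>2 + q\<^sup>2 < 1"
    and "(\<Sum>i=1..m. \<bar>\<alpha> i\<bar>) = p * \<alpha>0" and "(\<Sum>i=1..m. \<bar>\<beta> i\<bar>) = q * \<beta>0"
proof
  \<comment> \<open>Division by zero yields zero, which agrees with omitting the fraction.\<close>
  let ?p = "(\<Sum>i=1..m. \<bar>\<alpha> i\<bar>) / \<alpha>0" and ?q = "(\<Sum>i=1..m. \<bar>\<beta> i\<bar>) / \<beta>0"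
  show "?p\<^sup>2 + ?q\<^sup>2 < 1"
    using assms by (auto simp: coeff_cond_def split: if_splits)
  show "(\<Sum>i=1..m. \<bar>\<alpha> i\<bar>) = ?p * \<alpha>0" "(\<Sum>i=1..m. \<bar>\<beta> i\<bar>) = ?q * \<beta>0"
    using assms by (auto simp: coeff_cond_def)
qed

lemma strict_Cauchy_Schwarz_2:
  fixes p q x y :: real
  assumes "p\<^sup>2 + q\<^sup>2 < 1" "x \<noteq> 0 \<or> y \<noteq> 0"
  shows "p * x + q * y < sqrt (x\<^sup>2 + y\<^sup>2)"
proof (rule real_less_rsqrt)
  have "(p * x + q * y)\<^sup>2 \<le> (p * x + q * y)\<^sup>2 + (p * y - q * x)\<^sup>2"
    by simp
  also have "\<dots> = (p\<^sup>2 + q\<^sup>2) * (x\<^sup>2 + y\<^sup>2)"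
    by algebra
  also have "\<dots> < 1 * (x\<^sup>2 + y\<^sup>2)"
    using assms by (intro mult_strict_right_mono) (auto simp: sum_power2_gt_zero_iff)
  finally show "(p * x + q * y)\<^sup>2 < x\<^sup>2 + y\<^sup>2"
    by simp
qed

lemma cmod_phasor_sum_le:
  assumes "s \<ge> 0"
  shows "cmod (\<Sum>i\<in>I. Complex (\<alpha> i) (s * \<beta> i) * cis (\<theta> i))
    \<le> (\<Sum>i\<in>I. \<bar>\<alpha> i\<bar>) + s * (\<Sum>i\<in>I. \<bar>\<beta> i\<bar>)"
proof -
  have "cmod (Complex (\<alpha> i) (s * \<beta> i) * cis (\<theta> i)) \<le> \<bar>\<alpha> i\<bar> + s * \<bar>\<beta> i\<bar>" for i
    using cmod_le[of "Complex (\<alpha> i) (s * \<beta> i)"] assms by (simp add: norm_mult abs_mult)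
  then have "cmod (\<Sum>i\<in>I. Complex (\<alpha> i) (s * \<beta> i) * cis (\<theta> i))
      \<le> (\<Sum>i\<in>I. \<bar>\<alpha> i\<bar> + s * \<bar>\<beta> i\<bar>)"
    by (intro sum_norm_le) simp
  then show ?thesis
    by (simp add: sum.distrib sum_distrib_left)
qed

text \<open>On \<open>exp (\<i> s x)\<close> differentiation is multiplication by \<open>\<i> s\<close>, so a term
  \<open>\<alpha> u(\<eta>) + \<beta> u'(\<eta>)\<close> becomes \<open>(\<alpha> + \<i> s \<beta>) exp (\<i> s \<eta>)\<close>; its real part belongs to
  \<open>fund_cos s\<close> and its imaginary part to \<open>s\<close> times \<open>fund_sin s\<close>.\<close>

lemma boundary_defect_phasor:
  "Complex
     (boundary_defect m \<alpha>0 \<beta>0 \<eta>0 \<alpha> \<beta> \<eta> (fund_cos s) (\<lambda>x. - s\<^sup>2 * fund_sin s x))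
     (s * boundary_defect m \<alpha>0 \<beta>0 \<eta>0 \<alpha> \<beta> \<eta> (fund_sin s) (fund_cos s)) =
   Complex \<alpha>0 (s * \<beta>0) * cis (s * \<eta>0) -
   (\<Sum>i=1..m. Complex (\<alpha> i) (s * \<beta> i) * cis (s * \<eta> i))"
  by (simp add: complex_eq_iff boundary_defect_def fund_cos_def flip: mult_fund_sin)
    (simp add: algebra_simps power2_eq_square sum.distrib sum_distrib_left sum_negf sum_subtractf)

text \<open>The defect does not vanish on the whole solution plane. The phasor \<open>\<alpha>0 + \<i> s \<beta>0\<close> dominates
  the others unless it is zero, and then the defect of \<open>fund_sin 0\<close> is dominated by \<open>\<beta>0\<close>.\<close>

lemma boundary_defect_nonzero:
  assumes "\<alpha>0 \<ge> 0" "\<alpha>0 + \<bar>\<beta>0\<bar> > 0" "coeff_cond m \<alpha>0 \<beta>0 \<alpha> \<beta>" "s \<ge> 0"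
  shows "boundary_defect m \<alpha>0 \<beta>0 \<eta>0 \<alpha> \<beta> \<eta> (fund_cos s) (\<lambda>x. - s\<^sup>2 * fund_sin s x) \<noteq> 0 \<or>
    boundary_defect m \<alpha>0 \<beta>0 \<eta>0 \<alpha> \<beta> \<eta> (fund_sin s) (fund_cos s) \<noteq> 0"
proof (rule ccontr)
  assume "\<not> ?thesis"
  then have zero:
    "boundary_defect m \<alpha>0 \<beta>0 \<eta>0 \<alpha> \<beta> \<eta> (fund_cos s) (\<lambda>x. - s\<^sup>2 * fund_sin s x) = 0"
    "boundary_defect m \<alpha>0 \<beta>0 \<eta>0 \<alpha> \<beta> \<eta> (fund_sin s) (fund_cos s) = 0"
    by auto
  obtain p q where pq: "p\<^sup>2 + q\<^sup>2 < 1"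
    and A: "(\<Sum>i=1..m. \<bar>\<alpha> i\<bar>) = p * \<alpha>0" and B: "(\<Sum>i=1..m. \<bar>\<beta> i\<bar>) = q * \<beta>0"
    using coeff_cond_ratios[OF assms(3)] by blast
  show False
  proof (cases "\<alpha>0 = 0 \<and> s * \<beta>0 = 0")
    case False
    have "Complex \<alpha>0 (s * \<beta>0) * cis (s * \<eta>0) =
        (\<Sum>i=1..m. Complex (\<alpha> i) (s * \<beta> i) * cis (s * \<eta> i))"
      using boundary_defect_phasor[of m \<alpha>0 \<beta>0 \<eta>0 \<alpha> \<beta> \<eta> s]
      unfolding zero mult_zero_right zero_complex.code[symmetric] by simp
    then have "cmod (Complex \<alpha>0 (s * \<beta>0) * cis (s * \<eta>0)) \<le> p * \<alpha>0 + s * (q * \<beta>0)"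
      using cmod_phasor_sum_le[OF \<open>s \<ge> 0\<close>, of "\<lambda>i. \<alpha> i" "\<lambda>i. \<beta> i" "\<lambda>i. s * \<eta> i" "{1..m}"]
      by (simp add: A[symmetric] B[symmetric])
    also have "\<dots> = p * \<alpha>0 + q * (s * \<beta>0)"
      by simp
    also have "\<dots> < sqrt (\<alpha>0\<^sup>2 + (s * \<beta>0)\<^sup>2)"
      using strict_Cauchy_Schwarz_2[OF pq] False by blast
    finally show False
      by (simp add: norm_mult complex_norm)
  next
    case True
    then have "\<alpha>0 = 0" "\<beta>0 \<noteq> 0" "s = 0"
      using assms by auto
    have "(\<Sum>i=1..m. \<bar>\<alpha> i\<bar>) = 0"
      using A \<open>\<alpha>0 = 0\<close> by simp
    then have "\<alpha> i = 0" if "i \<in> {1..m}" for i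
      using that by (simp add: sum_nonneg_eq_0_iff)
    then have "\<beta>0 = (\<Sum>i=1..m. \<beta> i)"
      using zero(2) by (simp add: boundary_defect_def \<open>\<alpha>0 = 0\<close> \<open>s = 0\<close> fund_cos_def)
    then have "\<bar>\<beta>0\<bar> \<le> q * \<beta>0"
      using sum_abs[of \<beta> "{1..m}"] B by metis
    also have "\<dots> < \<bar>\<beta>0\<bar>"
      using strict_Cauchy_Schwarz_2[OF pq, of 0 \<beta>0] \<open>\<beta>0 \<noteq> 0\<close> by simp
    finally show False
      by simp
  qed
qed

section \<open>The solution line\<close>

text \<open>A solution \<open>a C + b S\<close> satisfies \<open>a P + b Q = 0\<close>, where \<open>P\<close> and \<open>Q\<close> are the defects of \<open>C\<close>
  and \<open>S\<close>; this line in the \<open>(a, b)\<close> plane is spanned by \<open>(Q, - P)\<close>.\<close>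

theorem theorem3p1:
  fixes m :: nat
    and \<alpha>0 \<beta>0 \<eta>0 lam :: real
    and \<alpha> \<beta> \<eta> :: "nat \<Rightarrow> real"
  assumes "m \<ge> 1"
    and "\<alpha>0 \<ge> 0"
    and "\<alpha>0 + \<bar>\<beta>0\<bar> > 0"
    and "coeff_cond m \<alpha>0 \<beta>0 \<alpha> \<beta>"
    and "lam \<ge> 0"
  shows "real_fun.subspace (solutions m \<alpha>0 \<beta>0 \<eta>0 \<alpha> \<beta> \<eta> lam) \<and>
         real_fun.dim (solutions m \<alpha>0 \<beta>0 \<eta>0 \<alpha> \<beta> \<eta> lam) = 1"
proof -
  define s where "s = sqrt lam"
  have s: "s \<ge> 0" and lam: "lam = s\<^sup>2"
    using \<open>lam \<ge> 0\<close> by (simp_all add: s_def)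
  let ?comb = "\<lambda>a b x. a * fund_cos s x + b * fund_sin s x"
  define P where
    "P = boundary_defect m \<alpha>0 \<beta>0 \<eta>0 \<alpha> \<beta> \<eta> (fund_cos s) (\<lambda>x. - s\<^sup>2 * fund_sin s x)"
  define Q where "Q = boundary_defect m \<alpha>0 \<beta>0 \<eta>0 \<alpha> \<beta> \<eta> (fund_sin s) (fund_cos s)"
  have PQ: "P \<noteq> 0 \<or> Q \<noteq> 0"
    unfolding P_def Q_def by (rule boundary_defect_nonzero) (use assms s in auto)
  define w where "w = ?comb Q (- P)"

  have solutions_eq: "solutions m \<alpha>0 \<beta>0 \<eta>0 \<alpha> \<beta> \<eta> lam =
      {u. (\<exists>a b. u = ?comb a b) \<and> boundary_defect m \<alpha>0 \<beta>0 \<eta>0 \<alpha> \<beta> \<eta> u (deriv u) = 0}"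
    unfolding solutions_def lam harmonic_iff_fund_comb[symmetric]
    by (auto simp: boundary_defect_def sum.distrib)
  have defect: "boundary_defect m \<alpha>0 \<beta>0 \<eta>0 \<alpha> \<beta> \<eta> (?comb a b) (deriv (?comb a b)) = a * P + b * Q"
    for a b
    by (simp only: deriv_fund_comb boundary_defect_linear P_def Q_def)
  have scale_w: "fun_scale k w = ?comb (k * Q) (k * - P)" for k
    by (simp add: fun_scale_def w_def fun_eq_iff algebra_simps)
  have "solutions m \<alpha>0 \<beta>0 \<eta>0 \<alpha> \<beta> \<eta> lam = range (\<lambda>k. fun_scale k w)"
  proof (intro subset_antisym subsetI)
    fix u assume "u \<in> solutions m \<alpha>0 \<beta>0 \<eta>0 \<alpha> \<beta> \<eta> lam"
    then obtain a b where u: "u = ?comb a b" and ab: "a * P + b * Q = 0"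
      using defect unfolding solutions_eq by auto
    have "\<exists>k. a = k * Q \<and> b = k * - P"
    proof (cases "Q = 0")
      case True
      then show ?thesis
        using ab PQ by (intro exI[of _ "- b / P"]) auto
    next
      case False
      then have "b = a / Q * - P"
        using ab by (simp add: field_simps)
      then show ?thesis
        using False by (intro exI[of _ "a / Q"]) simp
    qed
    then show "u \<in> range (\<lambda>k. fun_scale k w)"
      using u scale_w by auto
  next
    fix u assume "u \<in> range (\<lambda>k. fun_scale k w)"
    then obtain k where u: "u = ?comb (k * Q) (k * - P)"
      using scale_w by auto
    then have "boundary_defect m \<alpha>0 \<beta>0 \<eta>0 \<alpha> \<beta> \<eta> u (deriv u) = 0"
      using defect[of "k * Q" "k * - P"] by simp
    then show "u \<in> solutions m \<alpha>0 \<beta>0 \<eta>0 \<alpha> \<beta> \<eta> lam"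
      unfolding solutions_eq using u by blast
  qed
  then have span: "solutions m \<alpha>0 \<beta>0 \<eta>0 \<alpha> \<beta> \<eta> lam = real_fun.span {w}"
    by (simp add: real_fun.span_singleton)

  have "w \<noteq> 0"
  proof
    assume "w = 0"
    then have w0: "w x = 0" for x
      by simp
    \<comment> \<open>The value and the slope of \<open>w\<close> at the origin are \<open>Q\<close> and \<open>- P\<close>.\<close>
    have "deriv w 0 = - P"
      unfolding w_def deriv_fund_comb by simp
    moreover have "w = (\<lambda>x. 0)"
      using w0 by blast
    ultimately have "P = 0"
      by simp
    moreover have "Q = 0"
      using w0[of 0] by (simp add: w_def)
    ultimately show False
      using PQ by simp
  qed
  then have "real_fun.dim (real_fun.span {w}) = 1"
    by (simp add: real_fun.dim_eq_card_independent)
  then show ?thesis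
    using real_fun.subspace_span[of "{w}"] unfolding span by simp
qed

end
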